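(* Consider the time-dependent balls and bins model with feedback exponent $\alpha>1$. Suppose that the limit $\theta=\lim_{n\to\infty}\alpha^{-n}\log\tau_n$ exists in $[0,\infty]$ and $\theta=\infty$. Then $\mathbb{P}(\mathcal{M})=0$, where $$\mathcal{M}=\{B_n=0\text{ for all sufficiently large }n\}\cup\{B_n=\sigma_n\text{ for all sufficiently large }n\}.$$
   Context: The time-dependent balls and bins model with two bins: let $(\sigma_n)_{n\ge 1}$ be a sequence of positive integers, let $\tau_0$ and $T_0$ be integers with $0<T_0<\tau_0$, and let $\tau_n=\tau_0+\sum_{i=1}^n\sigma_i$. With feedback exponent $\alpha$, define for $n\ge 0$: $\Theta_n=T_n/\tau_n$, $P_n=\frac{\Theta_n^{\alpha}}{\Theta_n^{\alpha}+(1-\Theta_n)^{\alpha}}$, and $T_{n+1}=T_n+B_{n+1}$, where conditionally on $\mathcal{F}_n=\sigma(B_1,\dots,B_n)$ the random variable $B_{n+1}$ is Binomial with size $\sigma_{n+1}$ (number of trials) and success probability $P_n$. Thus $T_n$ is the number of balls in the first bin at time $n$ out of $\tau_n$ balls in total. The event $\mathcal{M}$ is called monopoly. *)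

theory Defs
  imports "HOL-Probability.Probability"
begin

definition bb_tau :: "(nat \<Rightarrow> nat) \<Rightarrow> nat \<Rightarrow> nat \<Rightarrow> nat" where
  "bb_tau \<sigma> \<tau>0 n = \<tau>0 + (\<Sum>i=1..n. \<sigma> i)"

definition bb_T :: "nat \<Rightarrow> (nat \<Rightarrow> 'a \<Rightarrow> nat) \<Rightarrow> nat \<Rightarrow> 'a \<Rightarrow> nat" where
  "bb_T T0 B n \<omega> = T0 + (\<Sum>i=1..n. B i \<omega>)"

definition bb_Theta ::
  "(nat \<Rightarrow> nat) \<Rightarrow> nat \<Rightarrow> nat \<Rightarrow> (nat \<Rightarrow> 'a \<Rightarrow> nat) \<Rightarrow> nat \<Rightarrow> 'a \<Rightarrow> real" where
  "bb_Theta \<sigma> \<tau>0 T0 B n \<omega> = real (bb_T T0 B n \<omega>) / real (bb_tau \<sigma> \<tau>0 n)"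

definition bb_P ::
  "real \<Rightarrow> (nat \<Rightarrow> nat) \<Rightarrow> nat \<Rightarrow> nat \<Rightarrow> (nat \<Rightarrow> 'a \<Rightarrow> nat) \<Rightarrow> nat \<Rightarrow> 'a \<Rightarrow> real" where
  "bb_P \<alpha> \<sigma> \<tau>0 T0 B n \<omega> =
     bb_Theta \<sigma> \<tau>0 T0 B n \<omega> powr \<alpha> /
     (bb_Theta \<sigma> \<tau>0 T0 B n \<omega> powr \<alpha> + (1 - bb_Theta \<sigma> \<tau>0 T0 B n \<omega>) powr \<alpha>)"

(* Written with sigma rather than as a supremum of vimage algebras, because the
   supremum over the empty index set (n = 0) would have empty space. *)
definition bb_history :: "'a measure \<Rightarrow> (nat \<Rightarrow> 'a \<Rightarrow> nat) \<Rightarrow> nat \<Rightarrow> 'a measure" where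
  "bb_history M B n = sigma (space M) {B i -` A \<inter> space M | i A. i \<in> {1..n}}"

(* B 0 and \<sigma> 0 play no role: both sequences are indexed from 1. *)
locale balls_bins = prob_space M
  for M :: "'a measure" and \<alpha> :: real and \<sigma> :: "nat \<Rightarrow> nat"
    and \<tau>0 T0 :: nat and B :: "nat \<Rightarrow> 'a \<Rightarrow> nat" +
  assumes sigma_pos: "\<And>n. n \<ge> 1 \<Longrightarrow> \<sigma> n > 0"
    and T0_bounds: "0 < T0" "T0 < \<tau>0"
    and B_measurable: "\<And>n. n \<ge> 1 \<Longrightarrow> B n \<in> measurable M (count_space UNIV)"
    and B_cond_law: "\<And>n k. AE \<omega> in M.
      real_cond_exp M (bb_history M B n) (indicator {\<omega> \<in> space M. B (Suc n) \<omega> = k}) \<omega> =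
      pmf (binomial_pmf (\<sigma> (Suc n)) (bb_P \<alpha> \<sigma> \<tau>0 T0 B n \<omega>)) k"

definition bb_monopoly :: "'a measure \<Rightarrow> (nat \<Rightarrow> nat) \<Rightarrow> (nat \<Rightarrow> 'a \<Rightarrow> nat) \<Rightarrow> 'a set" where
  "bb_monopoly M \<sigma> B =
     {\<omega> \<in> space M. eventually (\<lambda>n. B n \<omega> = 0) sequentially} \<union>
     {\<omega> \<in> space M. eventually (\<lambda>n. B n \<omega> = \<sigma> n) sequentially}"

end

theory Submission
  imports Defs
begin

text \<open>
  As long as both bins are nonempty, each of them receives a given ball at time \<open>n + 1\<close> with
  probability at least \<open>\<tau>\<^sub>n powr (- \<alpha>)\<close>. Hence, whatever the past, the probability that a given bin
  takes all of the \<open>\<sigma>\<^sub>n\<^sub>+\<^sub>1\<close> balls is at most \<open>exp (- \<sigma>\<^sub>n\<^sub>+\<^sub>1 * \<tau>\<^sub>n powr (- \<alpha>))\<close>, and monopoly is null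
  once the exponents sum to infinity. If they were summable, then \<open>\<tau>\<^sub>n\<^sub>+\<^sub>1 \<le> 2 * \<tau>\<^sub>n powr \<alpha>\<close> would hold
  eventually, which keeps \<open>ln \<tau>\<^sub>n / \<alpha>\<^sup>n\<close> bounded.
\<close>

section \<open>Deterministic estimates: growth of the total and bounds on the success
  probability\<close>

lemma bb_tau_Suc: "bb_tau \<sigma> \<tau>0 (Suc n) = bb_tau \<sigma> \<tau>0 n + \<sigma> (Suc n)"
  by (simp add: bb_tau_def)

text \<open>Summability enters only through the terms tending to 0: eventually
  \<open>s n \<le> t n powr \<alpha>\<close>, and from then on a shifted and rescaled logarithm of
  \<open>t n\<close> cannot increase.\<close>

lemma not_summable_growth:
  fixes t s :: "nat \<Rightarrow> real"
  assumes \<alpha>: "\<alpha> > 1"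
    and t_ge_1: "\<And>n. t n \<ge> 1"
    and t_Suc: "\<And>n. t (Suc n) = t n + s n"
    and lim: "(\<lambda>n. ereal (\<alpha> powr (- real n) * ln (t n))) \<longlonglongrightarrow> \<infinity>"
  shows "\<not> summable (\<lambda>n. s n * t n powr (- \<alpha>))"
proof
  assume "summable (\<lambda>n. s n * t n powr (- \<alpha>))"
  then have "(\<lambda>n. s n * t n powr (- \<alpha>)) \<longlonglongrightarrow> 0"
    by (rule summable_LIMSEQ_zero)
  then have "\<forall>\<^sub>F n in sequentially. s n * t n powr (- \<alpha>) < 1"
    by (rule order_tendstoD) simp
  then obtain N where N: "\<And>n. n \<ge> N \<Longrightarrow> s n * t n powr (- \<alpha>) < 1"
    by (auto simp: eventually_sequentially)
  define C where "C = ln 2 / (\<alpha> - 1)"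
  have C: "C + ln 2 = \<alpha> * C"
    using \<alpha> by (simp add: C_def field_simps)
  have C_nonneg: "C \<ge> 0"
    using \<alpha> by (simp add: C_def)
  \<comment> \<open>\<open>C\<close> is chosen so that adding it turns \<open>x \<mapsto> \<alpha> * x + ln 2\<close> into multiplication by \<open>\<alpha>\<close>.\<close>
  define L where "L n = \<alpha> powr (- real n) * (ln (t n) + C)" for n
  have L_Suc: "L (Suc n) \<le> L n" if "n \<ge> N" for n
  proof -
    have pos: "t n powr \<alpha> > 0" "t n > 0" "t (Suc n) > 0"
      using t_ge_1[of n] t_ge_1[of "Suc n"] by auto
    have "s n \<le> t n powr \<alpha>"
      using N[OF that] pos by (simp add: powr_minus field_simps)
    moreover have "t n \<le> t n powr \<alpha>"
      using powr_mono[of 1 \<alpha> "t n"] t_ge_1[of n] \<alpha> by simp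
    ultimately have "t (Suc n) \<le> 2 * t n powr \<alpha>"
      by (simp add: t_Suc)
    then have "ln (t (Suc n)) \<le> ln (2 * t n powr \<alpha>)"
      using pos by (subst ln_le_cancel_iff) auto
    also have "\<dots> = ln 2 + \<alpha> * ln (t n)"
      using pos by (simp add: ln_mult ln_powr)
    finally have "ln (t (Suc n)) + C \<le> \<alpha> * (ln (t n) + C)"
      using C by (simp add: algebra_simps)
    then have "L (Suc n) \<le> \<alpha> powr (- real (Suc n)) * (\<alpha> * (ln (t n) + C))"
      unfolding L_def by (rule mult_left_mono) simp
    also have "\<dots> = L n"
      using \<alpha> by (simp add: L_def powr_diff powr_minus field_simps powr_add)
    finally show ?thesis .
  qed
  have L_bound: "L n \<le> L N" if "n \<ge> N" for n
    using that by (induction n rule: dec_induct) (use L_Suc order_trans in blast)+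
  \<comment> \<open>The limit is infinite, so some term past \<open>N\<close> exceeds the fixed
    number \<open>L N\<close>. As \<open>C \<ge> 0\<close>, so does \<open>L n\<close>, against
    \<open>L_bound\<close>.\<close>
  have "\<forall>\<^sub>F n in sequentially. ereal (L N) < ereal (\<alpha> powr (- real n) * ln (t n))"
    using lim by (rule order_tendstoD) simp
  then obtain n where "n \<ge> N" and n: "L N < \<alpha> powr (- real n) * ln (t n)"
    by (auto simp: eventually_sequentially) (meson nle_le)
  note n
  also have "\<dots> \<le> L n"
    unfolding L_def using C_nonneg by (intro mult_left_mono) auto
  finally show False
    using L_bound[OF \<open>n \<ge> N\<close>] by simp
qed

text \<open>The partial sums increase, so if they failed to tend to infinity they would be bounded
  and the shifted series would converge. The start \<open>m\<close> is free because a run may begin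
  at any time.\<close>

lemma exp_minus_sum_tendsto_0:
  fixes x :: "nat \<Rightarrow> real"
  assumes nonneg: "\<And>n. x n \<ge> 0" and div: "\<not> summable x"
  shows "(\<lambda>n. exp (- (\<Sum>i=m..<n. x i))) \<longlonglongrightarrow> 0"
proof -
  have "filterlim (\<lambda>n. \<Sum>i=m..<n. x i) at_top sequentially"
    unfolding filterlim_at_top_ge[where c = 0] eventually_sequentially
  proof (intro allI impI, rule ccontr)
    fix Z :: real
    assume "\<not> (\<exists>N. \<forall>n\<ge>N. Z \<le> (\<Sum>i=m..<n. x i))"
    then have "\<exists>k\<ge>n. (\<Sum>i=m..<k. x i) < Z" for n
      by (meson not_le)
    moreover have "(\<Sum>i=m..<n. x i) \<le> (\<Sum>i=m..<k. x i)" if "n \<le> k" for n k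
      using nonneg that by (intro sum_mono2) auto
    ultimately have bound: "(\<Sum>i=m..<n. x i) \<le> Z" for n
      by (meson less_le_not_le order_trans)
    have "summable (\<lambda>i. x (i + m))"
    proof (rule summableI_nonneg_bounded)
      show "(\<Sum>i<n. x (i + m)) \<le> Z" for n
        using bound[of "n + m"] sum.shift_bounds_nat_ivl[of x 0 m n]
        by (simp add: atLeast0LessThan)
    qed (rule nonneg)
    with div show False
      by (simp add: summable_iff_shift)
  qed
  then show ?thesis
    by (simp add: filterlim_compose[OF exp_at_bot] filterlim_uminus_at_bot)
qed

lemma one_minus_power_le_exp:
  fixes p x :: real
  assumes "x \<le> p" "p \<le> 1"
  shows "(1 - p) ^ n \<le> exp (- (real n * x))"
proof -
  have "1 - p \<le> exp (- x)"
    using assms exp_ge_add_one_self[of "- x"] by simp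
  then have "(1 - p) ^ n \<le> exp (- x) ^ n"
    using assms by (intro power_mono) auto
  then show ?thesis
    by (simp add: exp_of_nat_mult[symmetric])
qed

text \<open>Since \<open>\<alpha> \<ge> 1\<close>, the denominator is at most
  \<open>x + (1 - x) = 1\<close>, so the ratio is at least \<open>x powr \<alpha>\<close>. The bound
  \<open>1 / t \<le> x\<close> says that the bin holds at least one of \<open>t\<close>
  balls.\<close>

lemma inverse_powr_le_ratio:
  fixes x t \<alpha> :: real
  assumes "\<alpha> \<ge> 1" "t > 0" "1 / t \<le> x" "x \<le> 1"
  shows "t powr (- \<alpha>) \<le> x powr \<alpha> / (x powr \<alpha> + (1 - x) powr \<alpha>)"
proof -
  have "x > 0"
    using assms by (smt (verit) divide_pos_pos)
  have "x powr \<alpha> \<le> x" "(1 - x) powr \<alpha> \<le> 1 - x"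
    using powr_mono'[of 1 \<alpha> x] powr_mono'[of 1 \<alpha> "1 - x"] assms \<open>x > 0\<close> by auto
  then have le: "x powr \<alpha> + (1 - x) powr \<alpha> \<le> 1"
    by simp
  have pos: "x powr \<alpha> + (1 - x) powr \<alpha> > 0"
    using \<open>x > 0\<close> by (simp add: add_pos_nonneg)
  have "t powr (- \<alpha>) = (1 / t) powr \<alpha>"
    using assms by (simp add: powr_divide powr_minus_divide)
  also have "\<dots> \<le> x powr \<alpha>"
    using assms by (intro powr_mono2) auto
  also have "\<dots> \<le> x powr \<alpha> / (x powr \<alpha> + (1 - x) powr \<alpha>)"
    using le pos by (simp add: pos_le_divide_eq mult_left_le)
  finally show ?thesis .
qed

section \<open>Consequences of the conditional law: one step, runs, eventual runs\<close>

context balls_bins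
begin

abbreviation "\<tau> \<equiv> bb_tau \<sigma> \<tau>0"
abbreviation "T \<equiv> bb_T T0 B"
abbreviation "P \<equiv> bb_P \<alpha> \<sigma> \<tau>0 T0 B"

lemma subalgebra_history: "subalgebra M (bb_history M B n)"
proof -
  have "{B i -` A \<inter> space M | i A. i \<in> {1..n}} \<subseteq> sets M"
    using B_measurable by (auto intro: measurable_sets)
  then show ?thesis
    unfolding subalgebra_def bb_history_def
    by (auto simp: space_measure_of_conv sets_measure_of_conv sets.sigma_sets_subset
             dest: sets.sets_into_space)
qed

text \<open>This lets a run serve as the event \<open>E\<close> of \<open>prob_next_le\<close>.
  Index 0 is excluded by \<open>m \<ge> 1\<close>, since the history records only
  \<open>B 1, ..., B n\<close>.\<close>

lemma run_in_history:
  assumes "m \<ge> 1"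
  shows "{\<omega> \<in> space M. \<forall>i\<in>{m..n}. B i \<omega> = c i} \<in> sets (bb_history M B n)"
proof -
  have sp: "space (bb_history M B n) = space M"
    using subalgebra_history by (simp add: subalgebra_def)
  have "{\<omega> \<in> space M. B i \<omega> = c i} \<in> sets (bb_history M B n)" if "i \<in> {m..n}" for i
  proof -
    have "{\<omega> \<in> space M. B i \<omega> = c i} = B i -` {c i} \<inter> space M"
      by auto
    moreover have "i \<in> {1..n}"
      using that assms by auto
    ultimately show ?thesis
      unfolding bb_history_def by (subst sets_measure_of) auto
  qed
  then show ?thesis
    by (intro sets.sets_Collect_finite_All[where M = "bb_history M B n", unfolded sp]) auto
qed

text \<open>On an event of the past, the indicator of the next outcome and its conditional
  expectation have the same integral. An almost sure bound \<open>q\<close> suffices, which matters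
  because \<open>T n \<omega> < \<tau> n\<close> is only known almost surely.\<close>

lemma prob_next_le:
  assumes E: "E \<in> sets (bb_history M B n)"
    and q: "AE \<omega> in M. pmf (binomial_pmf (\<sigma> (Suc n)) (P n \<omega>)) k \<le> q"
  shows "prob {\<omega> \<in> E. B (Suc n) \<omega> = k} \<le> q * prob E"
proof -
  let ?F = "bb_history M B n" and ?A = "{\<omega> \<in> space M. B (Suc n) \<omega> = k}"
  interpret finite_measure_subalgebra M ?F
    by unfold_locales (rule subalgebra_history)
  have EM: "E \<in> sets M"
    using E subalgebra_history by (auto simp: subalgebra_def)
  have A: "?A \<in> sets M"
    using B_measurable[of "Suc n"] by measurable
  have intA: "integrable M (indicator ?A :: 'a \<Rightarrow> real)"
    using A by (simp add: emeasure_eq_measure)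
  have "{\<omega> \<in> E. B (Suc n) \<omega> = k} = ?A \<inter> E"
    using sets.sets_into_space[OF EM] by auto
  then have "prob {\<omega> \<in> E. B (Suc n) \<omega> = k} = (\<integral>\<omega>\<in>E. indicator ?A \<omega> \<partial>M)"
    using A EM by (simp add: set_lebesgue_integral_def indicator_inter_arith[symmetric] Int_commute)
  also have "\<dots> = (\<integral>\<omega>\<in>E. real_cond_exp M ?F (indicator ?A) \<omega> \<partial>M)"
    by (rule real_cond_exp_intA[OF intA E])
  also have "\<dots> \<le> (\<integral>\<omega>\<in>E. q \<partial>M)"
    unfolding set_lebesgue_integral_def
  proof (rule integral_mono_AE)
    show "integrable M (\<lambda>\<omega>. indicator E \<omega> *\<^sub>R real_cond_exp M ?F (indicator ?A) \<omega>)"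
      using integrable_mult_indicator[OF EM real_cond_exp_int(1)[OF intA]] .
    show "integrable M (\<lambda>\<omega>. indicator E \<omega> *\<^sub>R q)"
      using EM by (intro integrable_mult_indicator) auto
    show "AE \<omega> in M. indicator E \<omega> *\<^sub>R real_cond_exp M ?F (indicator ?A) \<omega> \<le> indicator E \<omega> *\<^sub>R q"
      using B_cond_law[of n k] q by eventually_elim (auto simp: indicator_def)
  qed
  also have "\<dots> = q * prob E"
    using EM by (simp add: set_lebesgue_integral_def)
  finally show ?thesis .
qed

lemma P_nonneg: "0 \<le> P n \<omega>" and P_le_1: "P n \<omega> \<le> 1"
  by (auto simp: bb_P_def divide_le_eq_1 add_nonneg_nonneg less_le)

text \<open>The model constrains \<open>B\<close> only through its conditional law. Each of the
  countably many values above \<open>\<sigma> (Suc n)\<close> has binomial mass 0, so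
  \<open>prob_next_le\<close> applies with \<open>q = 0\<close> on the whole space.\<close>

lemma AE_B_le: "AE \<omega> in M. B (Suc n) \<omega> \<le> \<sigma> (Suc n)"
proof -
  have "AE \<omega> in M. B (Suc n) \<omega> \<noteq> k" if "k > \<sigma> (Suc n)" for k
  proof -
    have E: "space M \<in> sets (bb_history M B n)"
      using subalgebra_history[of n] by (metis sets.top subalgebra_def)
    have "prob {\<omega> \<in> space M. B (Suc n) \<omega> = k} \<le> 0 * prob (space M)"
      using that P_nonneg P_le_1 by (intro prob_next_le[OF E]) (simp add: binomial_eq_0)
    then have "prob {\<omega> \<in> space M. B (Suc n) \<omega> = k} = 0"
      using measure_nonneg[of M] by (simp add: order_antisym)
    moreover have "{\<omega> \<in> space M. B (Suc n) \<omega> = k} \<in> sets M"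
      using B_measurable[of "Suc n"] by measurable
    ultimately show ?thesis
      by (intro AE_I[of _ _ "{\<omega> \<in> space M. B (Suc n) \<omega> = k}"]) (auto simp: emeasure_eq_measure)
  qed
  then have "AE \<omega> in M. \<forall>k. k > \<sigma> (Suc n) \<longrightarrow> B (Suc n) \<omega> \<noteq> k"
    by (subst AE_all_countable) auto
  then show ?thesis
    by eventually_elim (metis not_le)
qed

text \<open>The second bin never becomes empty: it starts nonempty, and no increment of
  \<open>T\<close> exceeds that of \<open>\<tau>\<close>.\<close>

lemma AE_T_less: "AE \<omega> in M. T n \<omega> < \<tau> n"
proof (induction n)
  case 0
  then show ?case
    using T0_bounds by (simp add: bb_T_def bb_tau_def)
next
  case (Suc n)
  then show ?case
    using AE_B_le[of n] by eventually_elim (simp add: bb_T_def bb_tau_def)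
qed

lemma tau_pos: "\<tau> n > 0"
  using T0_bounds by (simp add: bb_tau_def)

lemma AE_pmf_next_le:
  assumes "\<alpha> > 1" and k: "k = 0 \<or> k = \<sigma> (Suc n)"
  shows "AE \<omega> in M. pmf (binomial_pmf (\<sigma> (Suc n)) (P n \<omega>)) k
    \<le> exp (- (real (\<sigma> (Suc n)) * real (\<tau> n) powr (- \<alpha>)))"
  using AE_T_less[of n]
proof eventually_elim
  case (elim \<omega>)
  define x where "x = bb_Theta \<sigma> \<tau>0 T0 B n \<omega>"
  have "1 \<le> T n \<omega>"
    using T0_bounds by (simp add: bb_T_def)
  then have x: "1 / real (\<tau> n) \<le> x" "x \<le> 1" "1 / real (\<tau> n) \<le> 1 - x"
    using elim tau_pos[of n] by (auto simp: x_def bb_Theta_def field_simps)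
  then have x0: "0 \<le> x"
    by (smt (verit) of_nat_0_le_iff divide_nonneg_nonneg)
  have P: "P n \<omega> = x powr \<alpha> / (x powr \<alpha> + (1 - x) powr \<alpha>)"
    by (simp add: bb_P_def x_def)
  have ne: "x powr \<alpha> + (1 - x) powr \<alpha> \<noteq> 0"
    by (auto simp: add_nonneg_eq_0_iff)
  \<comment> \<open>The two bins play symmetric roles under \<open>x \<mapsto> 1 - x\<close>. The
    unsimplified \<open>1 - (1 - x)\<close> makes this an instance of
    \<open>inverse_powr_le_ratio\<close>.\<close>
  have P': "1 - P n \<omega> = (1 - x) powr \<alpha> / ((1 - x) powr \<alpha> + (1 - (1 - x)) powr \<alpha>)"
    using ne by (simp add: P field_simps)
  have "real (\<tau> n) powr (- \<alpha>) \<le> P n \<omega>"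
    unfolding P using assms(1) x tau_pos[of n] by (intro inverse_powr_le_ratio) auto
  then have 0: "(1 - P n \<omega>) ^ \<sigma> (Suc n) \<le> exp (- (real (\<sigma> (Suc n)) * real (\<tau> n) powr (- \<alpha>)))"
    using P_le_1 by (intro one_minus_power_le_exp)
  have "real (\<tau> n) powr (- \<alpha>) \<le> 1 - P n \<omega>"
    unfolding P' using assms(1) x x0 tau_pos[of n] by (intro inverse_powr_le_ratio) auto
  then have 1: "P n \<omega> ^ \<sigma> (Suc n) \<le> exp (- (real (\<sigma> (Suc n)) * real (\<tau> n) powr (- \<alpha>)))"
    using P_nonneg[of n \<omega>] one_minus_power_le_exp[of _ "1 - P n \<omega>"] by simp
  show ?case
    using k 0 1 P_nonneg[of n \<omega>] P_le_1[of n \<omega>] by auto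
qed

text \<open>Each induction step conditions on the run so far. A general \<open>c\<close> covers both
  bins at once. The indices differ by one because \<open>B (Suc i)\<close> is drawn with the
  proportions at time \<open>i\<close>.\<close>

lemma prob_run_le:
  assumes "\<alpha> > 1" and c: "\<And>i. c i = 0 \<or> c i = \<sigma> i" and "m \<le> n"
  shows "prob {\<omega> \<in> space M. \<forall>i\<in>{Suc m..n}. B i \<omega> = c i}
    \<le> exp (- (\<Sum>i=m..<n. real (\<sigma> (Suc i)) * real (\<tau> i) powr (- \<alpha>)))"
  using \<open>m \<le> n\<close>
proof (induction n rule: dec_induct)
  case base
  then show ?case
    by (simp add: prob_space)
next
  case (step n)
  let ?E = "{\<omega> \<in> space M. \<forall>i\<in>{Suc m..n}. B i \<omega> = c i}"
  let ?x = "real (\<sigma> (Suc n)) * real (\<tau> n) powr (- \<alpha>)"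
  have "{\<omega> \<in> space M. \<forall>i\<in>{Suc m..Suc n}. B i \<omega> = c i} = {\<omega> \<in> ?E. B (Suc n) \<omega> = c (Suc n)}"
    using step.hyps by (auto simp: le_Suc_eq)
  also have "prob \<dots> \<le> exp (- ?x) * prob ?E"
    by (intro prob_next_le run_in_history AE_pmf_next_le assms) simp
  also have "\<dots> \<le> exp (- ?x) * exp (- (\<Sum>i=m..<n. real (\<sigma> (Suc i)) * real (\<tau> i) powr (- \<alpha>)))"
    using step.IH by (intro mult_left_mono) auto
  finally show ?case
    using step.hyps(1) by (simp add: exp_add[symmetric] algebra_simps)
qed

text \<open>An infinite run from \<open>Suc m\<close> on lies in every finite run from there, so its
  probability is below bounds tending to 0. Countably many starting times cover all eventual
  runs.\<close>

lemma AE_not_eventually: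
  assumes "\<alpha> > 1" and c: "\<And>i. c i = 0 \<or> c i = \<sigma> i"
    and div: "\<not> summable (\<lambda>n. real (\<sigma> (Suc n)) * real (\<tau> n) powr (- \<alpha>))"
  shows "AE \<omega> in M. \<not> (\<forall>\<^sub>F n in sequentially. B n \<omega> = c n)"
proof -
  have "AE \<omega> in M. \<not> (\<forall>i\<ge>Suc m. B i \<omega> = c i)" for m
  proof -
    define E where "E = {\<omega> \<in> space M. \<forall>i\<ge>Suc m. B i \<omega> = c i}"
    have run: "{\<omega> \<in> space M. \<forall>i\<in>{Suc m..n}. B i \<omega> = c i} \<in> sets M" for n
      using run_in_history[of "Suc m" n c] subalgebra_history[of n] by (auto simp: subalgebra_def)
    have "E = {\<omega> \<in> space M. \<forall>n. \<forall>i\<in>{Suc m..n}. B i \<omega> = c i}"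
      unfolding E_def by force
    with run have E: "E \<in> sets M"
      by (simp only: sets.sets_Collect_countable_All)
    have "prob E \<le> exp (- (\<Sum>i=m..<n. real (\<sigma> (Suc i)) * real (\<tau> i) powr (- \<alpha>)))"
      if "n \<ge> m" for n
    proof -
      have "prob E \<le> prob {\<omega> \<in> space M. \<forall>i\<in>{Suc m..n}. B i \<omega> = c i}"
        using run by (intro finite_measure_mono) (auto simp: E_def)
      also note prob_run_le[OF assms(1) c that]
      finally show ?thesis .
    qed
    then have "prob E \<le> 0"
      by (intro LIMSEQ_le_const[OF exp_minus_sum_tendsto_0[OF _ div, of m]]) auto
    then have "E \<in> null_sets M"
      using E measure_nonneg[of M E] by (simp add: null_sets_def emeasure_eq_measure)
    from AE_not_in[OF this] AE_space show ?thesis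
      by eventually_elim (simp add: E_def)
  qed
  then have "AE \<omega> in M. \<forall>m. \<not> (\<forall>i\<ge>Suc m. B i \<omega> = c i)"
    by (subst AE_all_countable) auto
  then show ?thesis
    by eventually_elim (unfold eventually_sequentially, meson Suc_leD)
qed

end

theorem theorem1p3:
  fixes M :: "'a measure" and \<alpha> :: real and \<sigma> :: "nat \<Rightarrow> nat"
    and \<tau>0 T0 :: nat and B :: "nat \<Rightarrow> 'a \<Rightarrow> nat" and \<theta> :: ereal
  assumes "balls_bins M \<alpha> \<sigma> \<tau>0 T0 B"
    and "\<alpha> > 1"
    and "(\<lambda>n. ereal (\<alpha> powr (- real n) * ln (real (bb_tau \<sigma> \<tau>0 n)))) \<longlonglongrightarrow> \<theta>"
    and "\<theta> = \<infinity>"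
  shows "measure M (bb_monopoly M \<sigma> B) = 0"
proof -
  interpret balls_bins M \<alpha> \<sigma> \<tau>0 T0 B
    by (fact assms(1))
  have "\<not> summable (\<lambda>n. real (\<sigma> (Suc n)) * real (bb_tau \<sigma> \<tau>0 n) powr (- \<alpha>))"
    using assms tau_pos
    by (intro not_summable_growth) (auto simp: bb_tau_Suc Suc_le_eq)
  note AE = AE_not_eventually[OF assms(2) _ this]
  \<comment> \<open>The choices \<open>c = 0\<close> and \<open>c = \<sigma>\<close> rule out the
    two halves of monopoly.\<close>
  have "AE \<omega> in M. \<omega> \<notin> bb_monopoly M \<sigma> B"
    using AE[of "\<lambda>_. 0", simplified] AE[of \<sigma>, simplified]
    by eventually_elim (auto simp: bb_monopoly_def)
  \<comment> \<open>The second case is vacuous, as the event is measurable; splitting is just shorter than showing so.\<close>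
  then show ?thesis
    by (cases "bb_monopoly M \<sigma> B \<in> sets M") (auto simp: prob_eq_0 measure_notin_sets)
qed

end
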